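(* Let $p$ be a prime, $m\in\{0,1,2,\dots\}\cup\{\infty\}$, and $s\in\mathbb{C}$ with $0<|s|<1$ be such that $\Delta^{(m)}_s>0$. Then the Hausdorff dimension of the set $\Upsilon^{(m)}_s(\mathbb{Q}_p)\subset\mathbb{C}$, and its local Hausdorff dimension at each of its points, are equal to $D_s$.
   Context: Each nonzero $x\in\mathbb{Q}_p$ is written uniquely as $x=\sum_{n\ge v(x)}x_np^n$ with $x_n\in\{0,\dots,p-1\}$ and $x_{v(x)}\neq0$; set $x_n=0$ for $n<v(x)$, $|x|_p=p^{-v(x)}$; for $x=0$ all digits are $0$, $v(0)=\infty$ and $|0|_p=0$. For $n\in\mathbb{Z}$ and $m\in\{0,1,2,\dots\}\cup\{\infty\}$ put $$\chi_n^{(m)}(x)=\exp\Big(\frac{2\pi i}{p}\sum_{k=0}^m x_{n-k}p^{-k}\Big).$$ For $0<|s|<1$ define $$\Upsilon^{(m)}_s(x)=\frac{1-s^{v(x)}}{1-s}+\sum_{n=v(x)}^\infty s^n\chi_n^{(m)}(x),$$ with $\Upsilon^{(m)}_s(0)=\frac1{1-s}$. Put $D_s=-1/\log_p|s|$ and $$\Delta^{(m)}_s=\inf\{|\Upsilon^{(m)}_s(x)-\Upsilon^{(m)}_s(y)|: x,y\in\mathbb{Q}_p,\ |x-y|_p=1\}.$$ The Hausdorff dimension $D_h(A)$ is the usual one ($\inf$ of $\delta$ with vanishing $\delta$-dimensional Hausdorff measure). The local Hausdorff dimension of $A$ at $x\in A$ is $\inf_{U} D_h(A\cap U)$ over all open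 neighborhoods $U$ of $x$. *)

theory Defs
  imports "HOL-Analysis.Analysis" "HOL-Computational_Algebra.Primes"
begin

definition rat_padic_abs :: "nat \<Rightarrow> rat \<Rightarrow> real" where
  "rat_padic_abs p q =
     (if q = 0 then 0
      else real p powi (int (multiplicity (int p) (snd (quotient_of q)))
                        - int (multiplicity (int p) (fst (quotient_of q)))))"

text \<open>The field of p-adic numbers is the completion of the rationals: classes of Cauchy
  sequences modulo null sequences.\<close>

definition padic_Cauchy :: "nat \<Rightarrow> (nat \<Rightarrow> rat) set" where
  "padic_Cauchy p =
     {X. \<forall>e>0. \<exists>M. \<forall>i\<ge>M. \<forall>j\<ge>M. rat_padic_abs p (X i - X j) < e}"

definition padic_rel :: "nat \<Rightarrow> ((nat \<Rightarrow> rat) \<times> (nat \<Rightarrow> rat)) set" where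
  "padic_rel p =
     {(X, Y). X \<in> padic_Cauchy p \<and> Y \<in> padic_Cauchy p
              \<and> (\<lambda>i. rat_padic_abs p (X i - Y i)) \<longlonglongrightarrow> 0}"

type_synonym padic = "(nat \<Rightarrow> rat) set"

definition Qp :: "nat \<Rightarrow> padic set" where
  "Qp p = padic_Cauchy p // padic_rel p"

definition padic_zero :: "nat \<Rightarrow> padic" where
  "padic_zero p = padic_rel p `` {\<lambda>_. 0}"

definition padic_diff :: "nat \<Rightarrow> padic \<Rightarrow> padic \<Rightarrow> padic" where
  "padic_diff p x y = (\<Union>X\<in>x. \<Union>Y\<in>y. padic_rel p `` {\<lambda>i. X i - Y i})"

text \<open>Membership of the sequence of partial sums in the class \<open>x\<close> says that the series
  converges to \<open>x\<close>; the lower summation limit is harmless because the support is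
  bounded below.\<close>

definition padic_expansion :: "nat \<Rightarrow> padic \<Rightarrow> (int \<Rightarrow> nat) \<Rightarrow> bool" where
  "padic_expansion p x d \<longleftrightarrow>
     (\<forall>n. d n < p) \<and> (\<exists>N. \<forall>n<N. d n = 0) \<and>
     (\<lambda>N. \<Sum>k\<in>{- int N..int N}. of_nat (d k) * of_nat p powi k) \<in> x"

definition padic_digit :: "nat \<Rightarrow> padic \<Rightarrow> int \<Rightarrow> nat" where
  "padic_digit p x = (THE d. padic_expansion p x d)"

text \<open>Only meaningful for nonzero \<open>x\<close>; the value at zero (infinity in the usual
  convention) is never used below.\<close>

definition padic_val :: "nat \<Rightarrow> padic \<Rightarrow> int" where
  "padic_val p x = (LEAST n. padic_digit p x n \<noteq> 0)"

definition padic_abs :: "nat \<Rightarrow> padic \<Rightarrow> real" where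
  "padic_abs p x = (if x = padic_zero p then 0 else real p powi (- padic_val p x))"

definition padic_chi :: "nat \<Rightarrow> enat \<Rightarrow> int \<Rightarrow> padic \<Rightarrow> complex" where
  "padic_chi p m n x =
     exp (2 * of_real pi * \<i> / of_nat p *
          of_real (\<Sum>\<^sub>\<infinity>k | enat k \<le> m. real (padic_digit p x (n - int k)) / real p ^ k))"

definition Upsilon :: "nat \<Rightarrow> enat \<Rightarrow> complex \<Rightarrow> padic \<Rightarrow> complex" where
  "Upsilon p m s x =
     (if x = padic_zero p then 1 / (1 - s)
      else (1 - s powi padic_val p x) / (1 - s)
           + (\<Sum>j. s powi (padic_val p x + int j) * padic_chi p m (padic_val p x + int j) x))"

definition D_exponent :: "nat \<Rightarrow> complex \<Rightarrow> real" where
  "D_exponent p s = - 1 / log (real p) (cmod s)"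

definition Delta :: "nat \<Rightarrow> enat \<Rightarrow> complex \<Rightarrow> real" where
  "Delta p m s =
     Inf {cmod (Upsilon p m s x - Upsilon p m s y) | x y.
            x \<in> Qp p \<and> y \<in> Qp p \<and> padic_abs p (padic_diff p x y) = 1}"

text \<open>The case distinctions give the usual conventions that the empty set contributes nothing
  and that a nonempty set contributes 1 when \<open>\<delta> = 0\<close> (note \<open>0 powr 0 = 0\<close>).\<close>

definition diameter_power :: "real \<Rightarrow> 'a::metric_space set \<Rightarrow> ennreal" where
  "diameter_power \<delta> U =
     (if U = {} then 0 else if \<delta> = 0 then 1 else ennreal (diameter U powr \<delta>))"

text \<open>Boundedness is required because \<^const>\<open>diameter\<close> is unspecified on unbounded sets.\<close>

definition hausdorff_premeasure :: "real \<Rightarrow> real \<Rightarrow> 'a::metric_space set \<Rightarrow> ennreal" where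
  "hausdorff_premeasure \<delta> \<epsilon> A =
     (INF U \<in> {U :: nat \<Rightarrow> 'a set. A \<subseteq> (\<Union>i. U i) \<and>
                 (\<forall>i. bounded (U i) \<and> diameter (U i) \<le> \<epsilon>)}.
        \<Sum>i. diameter_power \<delta> (U i))"

definition hausdorff_measure :: "real \<Rightarrow> 'a::metric_space set \<Rightarrow> ennreal" where
  "hausdorff_measure \<delta> A = (SUP \<epsilon>\<in>{0<..}. hausdorff_premeasure \<delta> \<epsilon> A)"

definition hausdorff_dim :: "'a::metric_space set \<Rightarrow> ereal" where
  "hausdorff_dim A = Inf (ereal ` {\<delta>. 0 \<le> \<delta> \<and> hausdorff_measure \<delta> A = 0})"

definition local_hausdorff_dim :: "'a::metric_space set \<Rightarrow> 'a \<Rightarrow> ereal" where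
  "local_hausdorff_dim A z = (INF U \<in> {U. open U \<and> z \<in> U}. hausdorff_dim (A \<inter> U))"

text \<open>The relation is an equivalence and every element of \<open>Qp p\<close> has exactly one digit
  expansion, so the quotient and the definite description in \<^const>\<open>padic_digit\<close>
  are meaningful. In the proof, \<open>val_ge p n q\<close> says that \<open>q\<close> has p-adic
  valuation at least \<open>n\<close>.\<close>

definition val_ge :: "nat \<Rightarrow> int \<Rightarrow> rat \<Rightarrow> bool" where
  "val_ge p n q \<longleftrightarrow> (\<exists>a b::int. \<not> int p dvd b \<and> q = of_int a / of_int b * of_nat p powi n)"

context fixes p :: nat assumes p: "prime p" begin

lemma prime_int_p: "prime (int p)" using p by simp
lemma p_gt: "p > 1" "p \<noteq> 0" "(of_nat p::rat) \<noteq> 0" using prime_gt_1_nat[OF p] by auto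

lemma int_decompose: "(a::int) \<noteq> 0 \<Longrightarrow> \<exists>a'. a = int p ^ multiplicity (int p) a * a' \<and> \<not> int p dvd a'"
  using multiplicity_decompose'[of a "int p"] prime_int_p by (metis not_prime_unit)

lemma rat_padic_abs_decompose: assumes "q \<noteq> 0" shows "\<exists>a b::int. \<exists>k. \<not> int p dvd a \<and> \<not> int p dvd b \<and> q = of_int a / of_int b * of_nat p powi k
    \<and> rat_padic_abs p q = real p powi (-k)"
proof -
  obtain x y where xy: "quotient_of q = (x,y)" by force
  have q: "q = of_int x / of_int y" by (rule quotient_of_div[OF xy])
  have "x \<noteq> 0" "y \<noteq> 0" using q assms by auto
  then obtain a b where ab: "x = int p ^ multiplicity (int p) x * a" "\<not> int p dvd a" "y = int p ^ multiplicity (int p) y * b" "\<not> int p dvd b"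
    using int_decompose by metis
  let ?i = "multiplicity (int p) x" let ?j = "multiplicity (int p) y"
  have "q = of_int a / of_int b * of_nat p powi (int ?i - int ?j)"
    using p_gt unfolding q by (subst ab(1), subst ab(3)) (simp add: power_int_diff ac_simps)
  moreover have "rat_padic_abs p q = real p powi (-(int ?i - int ?j))"
    using assms xy by (simp add: rat_padic_abs_def)
  ultimately show ?thesis using ab by blast
qed

lemma pw_aux: assumes "of_int a * (of_nat p::rat) powi k = of_int b" "k > 0" shows "int p dvd b"
proof -
  obtain n where n: "k = int (Suc n)" using assms(2) by (metis gr0_implies_Suc pos_int_cases)
  have "(of_int b::rat) = of_int (a * int p ^ Suc n)" using assms(1) unfolding n power_int_of_nat by simp
  hence "b = a * int p ^ Suc n" using of_int_eq_iff by blast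
  thus ?thesis by simp
qed

lemma val_ge_iff: "rat_padic_abs p q \<le> real p powi (-n) \<longleftrightarrow> val_ge p n q"
proof (cases "q = 0")
  case True
  have "val_ge p n 0" unfolding val_ge_def by (rule exI[of _ 0], rule exI[of _ 1]) (use prime_int_p in \<open>auto simp: not_prime_unit\<close>)
  thus ?thesis using True by (simp add: rat_padic_abs_def)
next
  case False
  obtain a b k where q: "\<not> int p dvd a" "\<not> int p dvd b" "q = of_int a / of_int b * of_nat p powi k"
    and ab: "rat_padic_abs p q = real p powi (-k)" using rat_padic_abs_decompose[OF False] by blast
  have "rat_padic_abs p q \<le> real p powi (-n) \<longleftrightarrow> n \<le> k"
    unfolding ab using p_gt using power_int_strict_increasing[of "-n" "-k" "real p"] power_int_increasing[of "-k" "-n" "real p"] by (force simp: not_le)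
  also have "\<dots> \<longleftrightarrow> val_ge p n q"
  proof
    assume "n \<le> k"
    then obtain j where j: "k = n + int j" by (metis zle_iff_zadd)
    show "val_ge p n q" unfolding val_ge_def
      by (rule exI[of _ "a * int p ^ j"], rule exI[of _ b]) (use q p_gt in \<open>simp add: j power_int_add\<close>)
  next
    assume "val_ge p n q"
    then obtain c d where cd: "\<not> int p dvd d" "q = of_int c / of_int d * of_nat p powi n" unfolding val_ge_def by blast
    show "n \<le> k"
    proof (rule ccontr)
      assume "\<not> n \<le> k"
      have nz: "b \<noteq> 0" "d \<noteq> 0" using q cd by auto
      have "of_int (c*b) * (of_nat p::rat) powi (n-k) = of_int (a * d)"
        using cd(2) q(3) nz p_gt by (simp add: power_int_diff field_simps)
      hence "int p dvd a * d" using pw_aux \<open>\<not> n \<le> k\<close> by (smt (verit, best))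
      thus False using q cd prime_int_p prime_dvd_mult_iff by blast
    qed
  qed
  finally show ?thesis .
qed

lemma val_ge_0: "val_ge p n 0" using val_ge_iff[of 0 n] by (simp add: rat_padic_abs_def)
lemma val_ge_uminus: "val_ge p n x \<Longrightarrow> val_ge p n (-x)"
  unfolding val_ge_def by (metis (no_types, opaque_lifting) minus_divide_left mult_minus_left of_int_minus)
lemma val_ge_add: assumes "val_ge p n x" "val_ge p n y" shows "val_ge p n (x+y)"
proof -
  obtain a b c d where "\<not> int p dvd b" "\<not> int p dvd d" "x = of_int a / of_int b * of_nat p powi n" "y = of_int c / of_int d * of_nat p powi n"
    using assms unfolding val_ge_def by blast
  moreover hence "b \<noteq> 0" "d \<noteq> 0" by auto
  moreover have "\<not> int p dvd b * d" using calculation prime_int_p prime_dvd_mult_iff by blast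
  ultimately show ?thesis unfolding val_ge_def
    by (intro exI[of _ "a*d+c*b"] exI[of _ "b*d"]) (auto simp: field_simps)
qed
lemma val_ge_diff: "val_ge p n x \<Longrightarrow> val_ge p n y \<Longrightarrow> val_ge p n (x-y)"
  using val_ge_add[of n x "-y"] val_ge_uminus by simp
lemma val_ge_sum: "(\<And>i. i\<in>A \<Longrightarrow> val_ge p n (f i)) \<Longrightarrow> val_ge p n (sum f A)"
  by (induction A rule: infinite_finite_induct) (auto simp: val_ge_0 val_ge_add)
lemma val_ge_mono: assumes "val_ge p n x" "m \<le> n" shows "val_ge p m x"
proof -
  have "real p powi (-n) \<le> real p powi (-m)" using p_gt assms(2) by (intro power_int_increasing) auto
  thus ?thesis using assms val_ge_iff by (meson order_trans)
qed
lemma val_ge_pow: "n \<le> k \<Longrightarrow> val_ge p n (of_nat d * of_nat p powi k)"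
  unfolding atomize_imp by (rule impI, rule val_ge_mono[of k], unfold val_ge_def, intro exI[of _ "int d"] exI[of _ 1]) (use p_gt in auto)

lemma powi_arbitrarily_small: assumes "e > 0" shows "\<exists>n. real p powi (-n) < e"
proof -
  obtain k where "(1/real p)^k < e" using real_arch_pow_inv[OF assms, of "1/real p"] p_gt by auto
  thus ?thesis by (intro exI[of _ "int k"]) (simp add: power_int_minus field_simps)
qed

lemma Cauchy_val_ge_iff: "X \<in> padic_Cauchy p \<longleftrightarrow> (\<forall>n. \<exists>M. \<forall>i\<ge>M. \<forall>j\<ge>M. val_ge p n (X i - X j))"
proof
  assume "X \<in> padic_Cauchy p"
  moreover have "real p powi (-n) > 0" for n using p_gt by simp
  ultimately show "\<forall>n. \<exists>M. \<forall>i\<ge>M. \<forall>j\<ge>M. val_ge p n (X i - X j)"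
    unfolding padic_Cauchy_def mem_Collect_eq val_ge_iff[symmetric] by (meson less_imp_le)
next
  assume *: "\<forall>n. \<exists>M. \<forall>i\<ge>M. \<forall>j\<ge>M. val_ge p n (X i - X j)"
  show "X \<in> padic_Cauchy p" unfolding padic_Cauchy_def mem_Collect_eq
    using * powi_arbitrarily_small unfolding val_ge_iff[symmetric] by (meson le_less_trans)
qed

lemma rat_padic_abs_nonneg: "rat_padic_abs p q \<ge> 0" by (simp add: rat_padic_abs_def)

lemma null_iff: "((\<lambda>i. rat_padic_abs p (Z i)) \<longlonglongrightarrow> 0) \<longleftrightarrow> (\<forall>n. \<exists>M. \<forall>i\<ge>M. val_ge p n (Z i))"
proof
  assume "(\<lambda>i. rat_padic_abs p (Z i)) \<longlonglongrightarrow> 0"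
  moreover have "real p powi (-n) > 0" for n using p_gt by simp
  ultimately show "\<forall>n. \<exists>M. \<forall>i\<ge>M. val_ge p n (Z i)"
    unfolding LIMSEQ_iff val_ge_iff[symmetric] using rat_padic_abs_nonneg 
    by (metis abs_of_nonneg diff_zero less_imp_le real_norm_def)
next
  assume *: "\<forall>n. \<exists>M. \<forall>i\<ge>M. val_ge p n (Z i)"
  show "(\<lambda>i. rat_padic_abs p (Z i)) \<longlonglongrightarrow> 0" unfolding LIMSEQ_iff
    using * powi_arbitrarily_small rat_padic_abs_nonneg unfolding val_ge_iff[symmetric]
    by (metis abs_of_nonneg diff_zero le_less_trans real_norm_def)
qed

lemma rel_iff: "(X,Y) \<in> padic_rel p \<longleftrightarrow> X \<in> padic_Cauchy p \<and> Y \<in> padic_Cauchy p \<and> (\<forall>n. \<exists>M. \<forall>i\<ge>M. val_ge p n (X i - Y i))"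
  unfolding padic_rel_def using null_iff[of "\<lambda>i. X i - Y i"] by simp

lemma equiv_padic_rel: "equiv (padic_Cauchy p) (padic_rel p)"
proof (rule equivI)
  show "padic_rel p \<subseteq> padic_Cauchy p \<times> padic_Cauchy p" by (auto simp: padic_rel_def)
  show "refl_on (padic_Cauchy p) (padic_rel p)" by (auto simp: refl_on_def rel_iff val_ge_0)
  show "sym (padic_rel p)" by (auto simp: sym_def rel_iff) (metis minus_diff_eq val_ge_uminus)
  show "trans (padic_rel p)"
  proof (rule transI)
    fix X Y Z assume h: "(X,Y) \<in> padic_rel p" "(Y,Z) \<in> padic_rel p"
    have "\<exists>M. \<forall>i\<ge>M. val_ge p n (X i - Z i)" for n
    proof -
      obtain M1 M2 where "\<forall>i\<ge>M1. val_ge p n (X i - Y i)" "\<forall>i\<ge>M2. val_ge p n (Y i - Z i)" using h unfolding rel_iff by blast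
      hence "\<forall>i\<ge>max M1 M2. val_ge p n ((X i - Y i) + (Y i - Z i))" using val_ge_add by (metis max.boundedE)
      hence "\<forall>i\<ge>max M1 M2. val_ge p n (X i - Z i)" by simp
      thus ?thesis by blast
    qed
    thus "(X,Z) \<in> padic_rel p" using h unfolding rel_iff by blast
  qed
qed

lemma digit_ex: assumes "val_ge p n q" shows "\<exists>d<p. val_ge p (n+1) (q - of_nat d * of_nat p powi n)"
proof -
  obtain a b where ab: "\<not> int p dvd b" "q = of_int a / of_int b * of_nat p powi n" using assms unfolding val_ge_def by blast
  have "coprime b (int p)" using prime_imp_coprime[OF prime_int_p ab(1)] by (simp add: coprime_commute)
  then obtain c w where c: "c * b + w * int p = 1" using bezout_int[of b "int p"] by auto
  define d where "d = nat ((a * c) mod int p)"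
  have d: "int d = (a*c) mod int p" "d < p" using p_gt by (auto simp: d_def nat_less_iff)
  have "a - b * (a * c) = a * (c * b + w * int p) - b * (a*c)" using c by simp
  also have "\<dots> = int p * (a * w)" by (simp add: algebra_simps)
  finally have "int p dvd a - b * (a*c)" by simp
  moreover have "int p dvd (a*c) - int d" unfolding d by simp
  ultimately have "int p dvd (a - b * (a*c)) + b * ((a*c) - int d)" by (intro dvd_add dvd_mult)
  hence "int p dvd a - b * int d" by (simp add: algebra_simps)
  then obtain e where e: "a - b * int d = int p * e" by blast
  have b0: "b \<noteq> 0" using ab by auto
  have "a = b * int d + int p * e" using e by simp
  hence "(of_int a::rat) = of_int b * of_nat d + of_nat p * of_int e" by (metis of_int_add of_int_mult of_int_of_nat_eq)
  hence "q - of_nat d * of_nat p powi n = of_int e / of_int b * of_nat p powi (n+1)"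
    unfolding ab(2) using p_gt b0 by (simp add: power_int_add field_simps)
  thus ?thesis using ab(1) d(2) unfolding val_ge_def by blast
qed

lemma digit_un: assumes "val_ge p (n+1) ((of_nat c - of_nat d) * of_nat p powi n)" "c < p" "d < p" shows "c = d"
proof (rule ccontr)
  assume "c \<noteq> d"
  obtain a b where ab: "\<not> int p dvd b" "(of_nat c - of_nat d) * of_nat p powi n = of_int a / of_int b * (of_nat p::rat) powi (n+1)"
    using assms unfolding val_ge_def by blast
  have "b \<noteq> 0" using ab by auto
  hence "((of_nat c - of_nat d) * of_int b) * (of_nat p::rat) powi n = (of_int a * of_nat p) * of_nat p powi n" using ab(2) p_gt by (simp add: power_int_add field_simps)
  hence "(of_nat c - of_nat d) * of_int b = (of_int a * of_nat p :: rat)" using p_gt by simp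
  hence "(of_int ((int c - int d)*b)::rat) = of_int (a * int p)" by simp
  hence "(int c - int d) * b = a * int p" using of_int_eq_iff by blast
  hence "int p dvd int c - int d" using ab(1) prime_int_p by (metis dvd_triv_right prime_dvd_mult_iff)
  thus False using assms(2,3) \<open>c\<noteq>d\<close> dvd_imp_le_int[of "int c - int d" "int p"] by auto
qed

abbreviation partial_sum :: "(int \<Rightarrow> nat) \<Rightarrow> nat \<Rightarrow> rat" where "partial_sum d N \<equiv> (\<Sum>k\<in>{- int N..int N}. of_nat (d k) * of_nat p powi k)"

lemma partial_sum_tail: assumes "\<forall>n<L. d n = 0" "- int N \<le> L" "n \<le> int N + 1"
  shows "val_ge p n (partial_sum d N - (\<Sum>k\<in>{L..<n}. of_nat (d k) * of_nat p powi k))"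
proof -
  have "partial_sum d N = (\<Sum>k\<in>{L..<n} \<union> {max L n..int N}. of_nat (d k) * of_nat p powi k)"
    by (rule sum.mono_neutral_right) (use assms in auto)
  also have "\<dots> = (\<Sum>k\<in>{L..<n}. of_nat (d k) * of_nat p powi k) + (\<Sum>k\<in>{max L n..int N}. of_nat (d k) * of_nat p powi k)"
    by (rule sum.union_disjoint) auto
  finally show ?thesis by (auto intro!: val_ge_sum val_ge_pow)
qed

lemma partial_sum_Cauchy: assumes "\<forall>n<L. d n = 0" shows "(\<lambda>N. partial_sum d N) \<in> padic_Cauchy p"
  unfolding Cauchy_val_ge_iff
proof
  fix n
  let ?M = "nat (max (-L) n)"
  have "val_ge p n (partial_sum d i - partial_sum d j)" if "i \<ge> ?M" "j \<ge> ?M" for i j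
    using val_ge_diff[OF partial_sum_tail[OF assms, of i n] partial_sum_tail[OF assms, of j n]] that by auto
  thus "\<exists>M. \<forall>i\<ge>M. \<forall>j\<ge>M. val_ge p n (partial_sum d i - partial_sum d j)" by blast
qed

lemma padic_expansion_ex1: assumes "x \<in> Qp p" shows "\<exists>!d. padic_expansion p x d"
proof (rule ex_ex1I)
  obtain X where X: "x = padic_rel p `` {X}" "X \<in> padic_Cauchy p" using assms unfolding Qp_def by (rule quotientE)
  obtain M where M: "\<And>n i j. i \<ge> M n \<Longrightarrow> j \<ge> M n \<Longrightarrow> val_ge p n (X i - X j)" using X(2) unfolding Cauchy_val_ge_iff by metis
  obtain L where L: "val_ge p L (X (M 0))" and L0: "L \<le> 0"
  proof (cases "X (M 0) = 0")
    case True thus ?thesis using that[of 0] val_ge_0 by simp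
  next
    case False
    then obtain k where "rat_padic_abs p (X (M 0)) = real p powi (-k)" using rat_padic_abs_decompose by blast
    hence "val_ge p k (X (M 0))" unfolding val_ge_iff[symmetric] by simp
    thus ?thesis using that[of "min k 0"] val_ge_mono by simp
  qed
  define T where "T = rec_nat (0::rat) (\<lambda>j t. t + of_nat (SOME d. d < p \<and> val_ge p (L+int j+1) (X (M (L+int j+1)) - t - of_nat d * of_nat p powi (L+int j))) * of_nat p powi (L+int j))"
  define e where "e j = (SOME d. d < p \<and> val_ge p (L+int j+1) (X (M (L+int j+1)) - T j - of_nat d * of_nat p powi (L+int j)))" for j
  have T0: "T 0 = 0" and TS: "\<And>j. T (Suc j) = T j + of_nat (e j) * of_nat p powi (L+int j)" unfolding T_def e_def by simp_all
  have near: "val_ge p n (X (M m) - X (M n))" if "n \<le> m" for n m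
  proof -
    let ?i = "max (M n) (M m)"
    have "val_ge p n (X (M m) - X ?i)" by (rule val_ge_mono[OF M that]) auto
    moreover have "val_ge p n (X ?i - X (M n))" by (rule M) auto
    ultimately show ?thesis using val_ge_add by fastforce
  qed
  have inv: "val_ge p (L+int j) (X (M (L+int j)) - T j)" and e: "e j < p" for j
  proof -
    have step: "e j < p \<and> val_ge p (L+int j+1) (X (M (L+int j+1)) - T (Suc j))" if "val_ge p (L+int j) (X (M (L+int j)) - T j)" for j
    proof -
      have "val_ge p (L+int j) (X (M (L+int j+1)) - T j)" 
        using val_ge_add[OF near[of "L+int j" "L+int j+1"] that] by simp
      from digit_ex[OF this] have "e j < p \<and> val_ge p (L+int j+1) (X (M (L+int j+1)) - T j - of_nat (e j) * of_nat p powi (L+int j))"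
        unfolding e_def by (intro someI_ex[of "\<lambda>d. d < p \<and> val_ge p (L+int j+1) (X (M (L+int j+1)) - T j - of_nat d * of_nat p powi (L+int j))"])
      thus ?thesis by (simp add: TS algebra_simps)
    qed
    have inv: "val_ge p (L+int j) (X (M (L+int j)) - T j)" for j
    proof (induction j)
      case 0
      have "val_ge p L (X (M 0) - X (M L))" using near L0 by simp
      from val_ge_diff[OF L this] show ?case by (simp add: T0)
    next
      case (Suc j) from step[OF this] show ?case by (simp add: algebra_simps)
    qed
    thus "val_ge p (L+int j) (X (M (L+int j)) - T j)" by simp
    show "e j < p" using step[OF inv] by simp
  qed
  define d where "d n = (if n < L then 0 else e (nat (n - L)))" for n
  have d0: "\<forall>n<L. d n = 0" by (simp add: d_def)
  have Td: "T j = (\<Sum>k\<in>{L..<L+int j}. of_nat (d k) * of_nat p powi k)" for j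
  proof (induction j)
    case (Suc j)
    have "{L..<L+int (Suc j)} = insert (L+int j) {L..<L+int j}" by auto
    thus ?case using Suc by (simp add: TS d_def)
  qed (simp add: T0)
  have "(X, \<lambda>N. partial_sum d N) \<in> padic_rel p" unfolding rel_iff
  proof (intro conjI X(2) partial_sum_Cauchy[OF d0] allI)
    fix n
    define j where "j = nat (max 0 (n - L))"
    have n: "n \<le> L + int j" by (simp add: j_def)
    have "val_ge p (L+int j) (X i - partial_sum d i)" if i: "i \<ge> M (L+int j)" "i \<ge> nat (max (-L) (L+int j))" for i
    proof -
      have "val_ge p (L+int j) (X i - X (M (L+int j)))" using M i by simp
      from val_ge_add[OF this inv] have "val_ge p (L+int j) (X i - T j)" by simp
      from val_ge_diff[OF this partial_sum_tail[OF d0, of i "L+int j", folded Td]] show ?thesis using i by simp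
    qed
    thus "\<exists>M. \<forall>i\<ge>M. val_ge p n (X i - partial_sum d i)" using val_ge_mono[OF _ n]
      by (intro exI[of _ "max (M (L+int j)) (nat (max (-L) (L+int j)))"]) auto
  qed
  moreover have "\<forall>n. d n < p" using e p_gt by (simp add: d_def)
  ultimately show "\<exists>d. padic_expansion p x d" unfolding padic_expansion_def X(1) using d0 by blast
next
  fix c d assume c: "padic_expansion p x c" and d: "padic_expansion p x d"
  obtain L1 L2 where "\<forall>n<L1. c n = 0" "\<forall>n<L2. d n = 0" using c d unfolding padic_expansion_def by blast
  then obtain L where L: "\<forall>n<L. c n = 0" "\<forall>n<L. d n = 0" by (metis min_less_iff_conj)
  have "((\<lambda>N. partial_sum c N), (\<lambda>N. partial_sum d N)) \<in> padic_rel p"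
    using c d assms equiv_padic_rel unfolding padic_expansion_def Qp_def by (meson quotient_eq_iff)
  hence small: "\<exists>M. \<forall>i\<ge>M. val_ge p n (partial_sum c i - partial_sum d i)" for n unfolding rel_iff by blast
  have "c n = d n" for n
  proof (induction "nat (n - L)" arbitrary: n rule: less_induct)
    case less
    show ?case
    proof (cases "n < L")
      case False
      obtain M where M: "\<forall>i\<ge>M. val_ge p (n+1) (partial_sum c i - partial_sum d i)" using small by blast
      define i where "i = max M (nat (max (-L) (n+1)))"
      have i: "i \<ge> M" "- int i \<le> L" "n+1 \<le> int i + 1" by (auto simp: i_def)
      have eq: "{L..<n+1} = insert n {L..<n}" using False by auto
      have s: "(\<Sum>k\<in>{L..<n}. of_nat (c k) * of_nat p powi k) = (\<Sum>k\<in>{L..<n}. of_nat (d k) * (of_nat p::rat) powi k)"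
        by (intro sum.cong refl) (use less in auto)
      have "val_ge p (n+1) (partial_sum c i - partial_sum d i - ((partial_sum c i - (\<Sum>k\<in>{L..<n+1}. of_nat (c k) * of_nat p powi k)) - (partial_sum d i - (\<Sum>k\<in>{L..<n+1}. of_nat (d k) * of_nat p powi k))))"
        by (rule val_ge_diff[OF M[rule_format, OF i(1)] val_ge_diff[OF partial_sum_tail[OF L(1) i(2) i(3)] partial_sum_tail[OF L(2) i(2) i(3)]]])
      hence "val_ge p (n+1) ((of_nat (c n) - of_nat (d n)) * of_nat p powi n)"
        unfolding eq by (simp add: s algebra_simps)
      thus ?thesis using digit_un c d unfolding padic_expansion_def by blast
    qed (use L in auto)
  qed
  thus "c = d" by blast
qed

end
end

theory Submission imports Defs begin

text \<open>
  Write \<open>r\<close> for \<open>\<bar>s\<bar>\<close> and \<open>D\<close> for the exponent, so that \<open>r powr D = 1 / p\<close>. The theorem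
  holds because \<open>\<Upsilon>\<close> is bi-Hoelder: if the digits of \<open>x\<close> and \<open>y\<close> agree below \<open>n\<close> and differ
  at \<open>n\<close>, that is \<open>\<bar>x - y\<bar> = p powi (-n)\<close>, then

    \<open>\<Delta> * r powi n \<le> \<bar>\<Upsilon> x - \<Upsilon> y\<bar> \<le> 2 / (1 - r) * r powi n\<close>

  (lemmas \<open>Upsilon_diff_ge\<close> and \<open>Upsilon_diff_le\<close>), and \<open>r powi n\<close> is the power \<open>1 / D\<close> of
  \<open>\<bar>x - y\<bar>\<close>. The characters of \<open>x\<close> and \<open>y\<close> agree below \<open>n\<close>, so the upper bound is a geometric
  tail. The lower bound for \<open>n = 0\<close> is the definition of \<open>\<Delta>\<close>, and it scales, because shifting
  the digits of both points by \<open>n\<close> places multiplies the difference of their images by \<open>s powi n\<close>.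

  The upper bound on the dimension comes from covers: a ball of radius \<open>p ^ L\<close> in the p-adic field
  is the union of \<open>p ^ (L + N)\<close> balls of radius \<open>p powi (-N)\<close>, whose images have diameter
  \<open>O(r ^ N)\<close>; for \<open>\<delta> > D\<close> the sum of the \<open>\<delta>\<close>-th powers is \<open>O((p * r powr \<delta>) ^ N)\<close> and tends
  to 0 (lemma \<open>hausdorff_measure_Upsilon_eq_0\<close>). The field is a countable union of such balls.

  For the lower bound, which has to hold near every point of the image, the base \<open>p\<close> digits of a
  real number \<open>t\<close> in \<open>[0,1)\<close> are put in place of the digits of \<open>x\<close> from a large index \<open>N\<close> on. The
  images of the resulting points stay in a given neighbourhood of \<open>\<Upsilon> x\<close>, and by the lower
  Hoelder bound \<open>\<bar>t - u\<bar>\<close> is at most a constant times the \<open>D\<close>-th power of the distance of the two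
  images. Hence a cover of the image by small sets yields a cover of \<open>[0,1)\<close> by intervals, and
  Lebesgue measure bounds the Hausdorff sums from below (lemma
  \<open>hausdorff_dim_ge_inverse_Holder\<close>).
\<close>

section \<open>Hausdorff measure and dimension\<close>

lemma hausdorff_measure_eq_0_iff:
  "hausdorff_measure \<delta> A = 0 \<longleftrightarrow> (\<forall>\<epsilon>>0. hausdorff_premeasure \<delta> \<epsilon> A = 0)"
  unfolding hausdorff_measure_def bot_ennreal[symmetric] SUP_bot_conv by auto

lemma hausdorff_premeasure_le:
  assumes "A \<subseteq> (\<Union>i. U i)" "\<And>i. bounded (U i)" "\<And>i. diameter (U i) \<le> \<epsilon>"
  shows "hausdorff_premeasure \<delta> \<epsilon> A \<le> (\<Sum>i. diameter_power \<delta> (U i))"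
  unfolding hausdorff_premeasure_def by (rule INF_lower) (use assms in auto)

text \<open>Within the same scale \<open>\<epsilon>\<close>, covers of the pieces with sums below \<open>e / 2 ^ (n + 1)\<close> are
  enumerated into a single cover along \<^const>\<open>prod_decode\<close>.\<close>

lemma hausdorff_measure_Union_eq_0:
  fixes A :: "nat \<Rightarrow> 'a::metric_space set"
  assumes "\<And>n. hausdorff_measure \<delta> (A n) = 0"
  shows "hausdorff_measure \<delta> (\<Union>n. A n) = 0"
  unfolding hausdorff_measure_eq_0_iff
proof (intro allI impI)
  fix \<epsilon> :: real assume "\<epsilon> > 0"
  have "hausdorff_premeasure \<delta> \<epsilon> (\<Union>n. A n) \<le> 0 + ennreal e" if "e > 0" for e
  proof -
    have "\<exists>U. A n \<subseteq> (\<Union>i. U i) \<and> (\<forall>i. bounded (U i) \<and> diameter (U i) \<le> \<epsilon>)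
        \<and> (\<Sum>i. diameter_power \<delta> (U i)) < ennreal (e * (1/2)^Suc n)" for n
    proof -
      have "hausdorff_premeasure \<delta> \<epsilon> (A n) < ennreal (e * (1/2)^Suc n)"
        using assms[of n] \<open>\<epsilon> > 0\<close> \<open>e > 0\<close> unfolding hausdorff_measure_eq_0_iff by simp
      thus ?thesis unfolding hausdorff_premeasure_def INF_less_iff by auto
    qed
    then obtain U where U: "\<And>n. A n \<subseteq> (\<Union>i. U n i)" "\<And>n i. bounded (U n i)" "\<And>n i. diameter (U n i) \<le> \<epsilon>"
        "\<And>n. (\<Sum>i. diameter_power \<delta> (U n i)) < ennreal (e * (1/2)^Suc n)"
      by metis
    define V where "V k = (case prod_decode k of (n, i) \<Rightarrow> U n i)" for k
    have "U n i \<subseteq> (\<Union>k. V k)" for n i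
      by (rule order_trans[OF _ UN_upper[of "prod_encode (n,i)"]]) (auto simp: V_def)
    hence "(\<Union>n. A n) \<subseteq> (\<Union>k. V k)"
      by (intro UN_least order_trans[OF U(1)]) blast
    hence "hausdorff_premeasure \<delta> \<epsilon> (\<Union>n. A n) \<le> (\<Sum>k. diameter_power \<delta> (V k))"
      by (rule hausdorff_premeasure_le) (auto simp: V_def U split: prod.split)
    also have "\<dots> = (\<Sum>k. case_prod (\<lambda>n i. diameter_power \<delta> (U n i)) (prod_decode k))"
      by (intro arg_cong[where f = suminf] ext) (simp add: V_def split: prod.split)
    also have "\<dots> = (\<Sum>n. \<Sum>i. diameter_power \<delta> (U n i))"
      using suminf_ennreal_2dimen[of "\<lambda>n. \<Sum>i. diameter_power \<delta> (U n i)" "\<lambda>(n,i). diameter_power \<delta> (U n i)"]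
      by (simp add: o_def)
    also have "\<dots> \<le> (\<Sum>n. ennreal (e * (1/2)^Suc n))"
      by (intro suminf_le less_imp_le[OF U(4)]) auto
    also have "\<dots> = ennreal e"
      using sums_mult[OF power_half_series, of e] \<open>e > 0\<close> by (intro suminf_ennreal_eq) auto
    finally show ?thesis by simp
  qed
  thus "hausdorff_premeasure \<delta> \<epsilon> (\<Union>n. A n) = 0"
    using ennreal_le_epsilon[of 0 "hausdorff_premeasure \<delta> \<epsilon> (\<Union>n. A n)"] by simp
qed

lemma hausdorff_premeasure_finite_cover_le:
  assumes "finite F" "A \<subseteq> \<Union>F" "\<And>U. U \<in> F \<Longrightarrow> bounded U" "\<And>U. U \<in> F \<Longrightarrow> diameter U \<le> d"
    and "0 < \<delta>" "0 \<le> d" "d \<le> \<epsilon>"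
  shows "hausdorff_premeasure \<delta> \<epsilon> A \<le> ennreal (card F * d powr \<delta>)"
proof -
  obtain g where g: "bij_betw g {..<card F} F"
    using ex_bij_betw_nat_finite[OF assms(1)] by (auto simp: atLeast0LessThan)
  define V where "V i = (if i < card F then g i else {})" for i
  have V: "bounded (V i) \<and> diameter (V i) \<le> d" for i
    using bij_betwE[OF g] assms by (auto simp: V_def)
  have "\<Union>F = (\<Union>i<card F. g i)"
    using bij_betw_imp_surj_on[OF g] by simp
  also have "\<dots> \<subseteq> (\<Union>i. V i)" by (fastforce simp: V_def)
  finally have "A \<subseteq> (\<Union>i. V i)" using assms(2) by (rule order_trans[rotated])
  hence "hausdorff_premeasure \<delta> \<epsilon> A \<le> (\<Sum>i. diameter_power \<delta> (V i))"
    using V assms(7) by (intro hausdorff_premeasure_le order_trans[OF _ assms(7)]) blast+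
  also have "\<dots> = (\<Sum>i<card F. diameter_power \<delta> (V i))"
    by (intro suminf_finite) (auto simp: V_def diameter_power_def)
  also have "\<dots> \<le> (\<Sum>i<card F. ennreal (d powr \<delta>))"
    using V assms(5) by (intro sum_mono) (auto simp: diameter_power_def intro!: ennreal_leI powr_mono2 diameter_ge_0)
  also have "\<dots> = ennreal (card F * d powr \<delta>)"
    by (simp add: ennreal_mult ennreal_of_nat_eq_real_of_nat)
  finally show ?thesis .
qed

text \<open>This is the usual box-counting upper bound: the \<open>N\<close>-th cover contributes at most
  \<open>K * C powr \<delta> * (b * r powr \<delta>) ^ N\<close>, which tends to 0 when the growth \<open>b\<close> of the number of sets
  is beaten by the decay of their diameters.\<close>

lemma hausdorff_measure_eq_0_geometric_covers:
  fixes A :: "'a::metric_space set" and K b C r \<delta> :: real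
  assumes cover: "\<And>N::nat. \<exists>F. finite F \<and> card F \<le> K * b ^ N \<and> A \<subseteq> \<Union>F \<and>
                      (\<forall>U\<in>F. bounded U \<and> diameter U \<le> C * r ^ N)"
    and pos: "0 < \<delta>" "0 \<le> C" "0 < r" "r < 1" "0 \<le> K" "0 < b" and small: "b * r powr \<delta> < 1"
  shows "hausdorff_measure \<delta> A = 0"
  unfolding hausdorff_measure_eq_0_iff
proof (intro allI impI)
  fix \<epsilon> :: real assume "\<epsilon> > 0"
  have "(\<lambda>N. C * r ^ N) \<longlonglongrightarrow> C * 0"
    by (intro tendsto_intros LIMSEQ_realpow_zero) (use pos in auto)
  hence ev: "\<forall>\<^sub>F N in sequentially. C * r ^ N < \<epsilon>"
    using \<open>\<epsilon> > 0\<close> by (simp add: order_tendstoD)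
  have "\<forall>\<^sub>F N in sequentially. hausdorff_premeasure \<delta> \<epsilon> A \<le> ennreal (K * C powr \<delta> * (b * r powr \<delta>) ^ N)"
    using ev
  proof eventually_elim
    case (elim N)
    obtain F where F: "finite F" "card F \<le> K * b ^ N" "A \<subseteq> \<Union>F" "\<forall>U\<in>F. bounded U \<and> diameter U \<le> C * r ^ N"
      using cover by blast
    have "hausdorff_premeasure \<delta> \<epsilon> A \<le> ennreal (card F * (C * r ^ N) powr \<delta>)"
      using F elim pos by (intro hausdorff_premeasure_finite_cover_le) auto
    also have "\<dots> \<le> ennreal (K * b ^ N * (C * r ^ N) powr \<delta>)"
      by (intro ennreal_leI mult_right_mono F) auto
    also have "(C * r ^ N) powr \<delta> = C powr \<delta> * (r powr \<delta>) ^ N"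
      using pos by (simp add: powr_mult powr_powr mult.commute flip: powr_realpow)
    finally show ?case by (simp add: power_mult_distrib mult_ac)
  qed
  moreover have "(\<lambda>N. ennreal (K * C powr \<delta> * (b * r powr \<delta>) ^ N)) \<longlonglongrightarrow> ennreal (K * C powr \<delta> * 0)"
    by (intro tendsto_intros tendsto_ennrealI LIMSEQ_realpow_zero) (use pos small in auto)
  ultimately have "hausdorff_premeasure \<delta> \<epsilon> A \<le> ennreal (K * C powr \<delta> * 0)"
    by (intro tendsto_lowerbound) auto
  thus "hausdorff_premeasure \<delta> \<epsilon> A = 0" by simp
qed

lemma hausdorff_dim_le:
  assumes "\<And>\<delta>. \<delta> > D \<Longrightarrow> hausdorff_measure \<delta> A = 0" "D \<ge> 0"
  shows "hausdorff_dim A \<le> ereal D"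
proof (rule ereal_le_epsilon2)
  fix e :: real assume "0 < e"
  thus "hausdorff_dim A \<le> ereal D + ereal e"
    unfolding hausdorff_dim_def using assms(1)[of "D + e"] assms(2) by (intro Inf_lower) auto
qed

text \<open>A cover of \<open>A\<close> pulls back along \<open>h\<close> to a cover of \<open>[0,1)\<close> by sets that lie in intervals of length \<open>2 * C * diameter (U i) powr D\<close>, and these
  lengths add up to at least 1. For sets of diameter at most 1, exponents smaller than \<open>D\<close> only
  increase the sum.\<close>

lemma hausdorff_dim_ge_inverse_Holder:
  fixes h :: "real \<Rightarrow> 'a::metric_space"
  assumes hA: "\<And>t. t \<in> {0..<1} \<Longrightarrow> h t \<in> A"
    and hold: "\<And>t u. t \<in> {0..<1} \<Longrightarrow> u \<in> {0..<1} \<Longrightarrow> \<bar>t - u\<bar> \<le> C * dist (h t) (h u) powr D"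
    and "C > 0" "D > 0"
  shows "ereal D \<le> hausdorff_dim A"
  unfolding hausdorff_dim_def
proof (intro Inf_greatest, clarify)
  fix \<delta> :: real assume \<delta>: "0 \<le> \<delta>" "hausdorff_measure \<delta> A = 0"
  have "ennreal (1 / (2 * C)) \<le> hausdorff_premeasure \<delta> 1 A" if "\<delta> < D"
    unfolding hausdorff_premeasure_def
  proof (intro INF_greatest, clarify)
    fix U :: "nat \<Rightarrow> 'a set" assume U: "A \<subseteq> (\<Union>i. U i)" "\<forall>i. bounded (U i) \<and> diameter (U i) \<le> 1"
    define T where "T i = {t \<in> {0..<1}. h t \<in> U i}" for i
    have "\<exists>J. T i \<subseteq> J \<and> J \<in> sets lborel \<and> emeasure lborel J \<le> ennreal (2 * C) * diameter_power \<delta> (U i)" for i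
    proof (cases "T i = {}")
      case False
      then obtain t where t: "t \<in> T i" by blast
      define R where "R = C * diameter (U i) powr D"
      have d: "0 \<le> diameter (U i)" using U by (simp add: diameter_ge_0)
      have "T i \<subseteq> {t - R..t + R}"
      proof
        fix u assume u: "u \<in> T i"
        have "\<bar>t - u\<bar> \<le> C * dist (h t) (h u) powr D" using t u hold by (auto simp: T_def)
        also have "\<dots> \<le> R" unfolding R_def
          using t u U(2) \<open>C > 0\<close> \<open>D > 0\<close> by (intro mult_left_mono powr_mono2 diameter_bounded_bound) (auto simp: T_def)
        finally show "u \<in> {t - R..t + R}" by auto
      qed
      moreover have "emeasure lborel {t - R..t + R} \<le> ennreal (2 * C) * diameter_power \<delta> (U i)"
      proof -
        have "0 \<le> R" using \<open>C > 0\<close> by (simp add: R_def)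
        hence "emeasure lborel {t - R..t + R} = ennreal (2 * C) * ennreal (diameter (U i) powr D)"
          using \<open>C > 0\<close> by (simp add: R_def ennreal_mult[symmetric])
        also have "ennreal (diameter (U i) powr D) \<le> diameter_power \<delta> (U i)"
        proof (cases "\<delta> = 0")
          case True
          thus ?thesis using t U(2) d \<open>D > 0\<close> powr_le1[of D "diameter (U i)"]
            by (auto simp: diameter_power_def T_def ennreal_le_1)
        next
          case False
          thus ?thesis using t U(2) d \<open>\<delta> < D\<close>
            by (auto simp: diameter_power_def T_def intro!: ennreal_leI powr_mono')
        qed
        finally show ?thesis by (simp add: mult_left_mono)
      qed
      ultimately show ?thesis by (intro exI[of _ "{t - R..t + R}"]) auto
    qed auto
    then obtain J where J: "\<And>i. T i \<subseteq> J i" "\<And>i. J i \<in> sets lborel"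
        "\<And>i. emeasure lborel (J i) \<le> ennreal (2 * C) * diameter_power \<delta> (U i)" by metis
    have "{0..<1::real} \<subseteq> (\<Union>i. T i)" using hA U(1) by (fastforce simp: T_def)
    hence "{0..<1::real} \<subseteq> (\<Union>i. J i)" using J(1) by blast
    hence "emeasure lborel {0..<1::real} \<le> emeasure lborel (\<Union>i. J i)"
      using J(2) by (intro emeasure_mono) auto
    also have "\<dots> \<le> (\<Sum>i. emeasure lborel (J i))"
      using J(2) by (intro emeasure_subadditive_countably) auto
    also have "\<dots> \<le> (\<Sum>i. ennreal (2 * C) * diameter_power \<delta> (U i))" by (intro suminf_le J(3)) auto
    also have "\<dots> = ennreal (2 * C) * (\<Sum>i. diameter_power \<delta> (U i))" by simp
    finally have *: "1 \<le> ennreal (2 * C) * (\<Sum>i. diameter_power \<delta> (U i))" by simp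
    have "ennreal (1 / (2 * C)) = ennreal (1 / (2 * C)) * 1" by simp
    also have "\<dots> \<le> ennreal (1 / (2 * C)) * (ennreal (2 * C) * (\<Sum>i. diameter_power \<delta> (U i)))"
      by (intro mult_left_mono *) auto
    also have "\<dots> = (\<Sum>i. diameter_power \<delta> (U i))"
      using \<open>C > 0\<close> by (simp add: mult.assoc[symmetric] ennreal_mult[symmetric])
    finally show "ennreal (1 / (2 * C)) \<le> (\<Sum>i. diameter_power \<delta> (U i))" .
  qed
  moreover have "hausdorff_premeasure \<delta> 1 A = 0" using \<delta> by (simp add: hausdorff_measure_eq_0_iff)
  ultimately show "ereal D \<le> ereal \<delta>" using \<open>C > 0\<close> by (cases "\<delta> < D") auto
qed

section \<open>Digits of p-adic numbers\<close>

text \<open>The integers are not well-ordered, so the least element defining the valuation is meaningful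
  only because the support of the digits is bounded below.\<close>

lemma int_Least_nonzero:
  fixes d :: "int \<Rightarrow> nat"
  assumes "\<forall>n<L. d n = 0" "d n0 \<noteq> 0"
  shows "d (LEAST n. d n \<noteq> 0) \<noteq> 0" "\<forall>n<(LEAST n. d n \<noteq> 0). d n = 0"
proof -
  define k where "k = (LEAST k. d (L + int k) \<noteq> 0)"
  have n0: "L \<le> n0" using assms by (meson not_less)
  hence "d (L + int (nat (n0 - L))) \<noteq> 0" using assms(2) by simp
  hence k: "d (L + int k) \<noteq> 0" unfolding k_def by (rule LeastI)
  have below: "d n = 0" if "n < L + int k" for n
  proof (cases "n < L")
    case False
    hence "n = L + int (nat (n - L))" "nat (n - L) < k" using that by auto
    thus ?thesis using not_less_Least[of "nat (n - L)" "\<lambda>k. d (L + int k) \<noteq> 0"] by (simp add: k_def)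
  qed (use assms(1) in simp)
  have "(LEAST n. d n \<noteq> 0) = L + int k"
  proof (rule Least_equality)
    show "d (L + int k) \<noteq> 0" by (fact k)
    show "L + int k \<le> n" if "d n \<noteq> 0" for n
      using below[of n] that by (meson not_less)
  qed
  thus "d (LEAST n. d n \<noteq> 0) \<noteq> 0" "\<forall>n<(LEAST n. d n \<noteq> 0). d n = 0" using k below by auto
qed

context fixes p :: nat assumes prime_p: "prime p" begin

lemma padic_digit_expansion: "x \<in> Qp p \<Longrightarrow> padic_expansion p x (padic_digit p x)"
  unfolding padic_digit_def by (rule theI'[OF padic_expansion_ex1[OF prime_p]])

lemma padic_digit_eqI: "x \<in> Qp p \<Longrightarrow> padic_expansion p x d \<Longrightarrow> padic_digit p x = d"
  using padic_expansion_ex1[OF prime_p] padic_digit_expansion by blast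

lemma padic_digit_less: "x \<in> Qp p \<Longrightarrow> padic_digit p x n < p"
  using padic_digit_expansion unfolding padic_expansion_def by blast

lemma padic_digit_bounded_below: "x \<in> Qp p \<Longrightarrow> \<exists>L. \<forall>n<L. padic_digit p x n = 0"
  using padic_digit_expansion unfolding padic_expansion_def by blast

lemma Qp_of_digits:
  assumes "\<And>n. d n < p" "\<And>n. n < L \<Longrightarrow> d n = 0"
  shows "\<exists>x\<in>Qp p. padic_digit p x = d"
proof -
  let ?X = "\<lambda>N. partial_sum p d N"
  have C: "?X \<in> padic_Cauchy p" using partial_sum_Cauchy[OF prime_p] assms(2) by blast
  hence Q: "padic_rel p `` {?X} \<in> Qp p" unfolding Qp_def by (rule quotientI)
  have "?X \<in> padic_rel p `` {?X}" using equiv_class_self[OF equiv_padic_rel[OF prime_p] C] .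
  hence "padic_expansion p (padic_rel p `` {?X}) d" using assms unfolding padic_expansion_def by blast
  thus ?thesis using Q padic_digit_eqI by blast
qed

lemma padic_zero_in_Qp: "padic_zero p \<in> Qp p"
  and padic_digit_zero: "padic_digit p (padic_zero p) = (\<lambda>_. 0)"
proof -
  have C: "(\<lambda>_. 0) \<in> padic_Cauchy p" by (auto simp: padic_Cauchy_def rat_padic_abs_def)
  show Q: "padic_zero p \<in> Qp p" unfolding Qp_def padic_zero_def by (rule quotientI[OF C])
  have "(\<lambda>_. 0) \<in> padic_zero p"
    unfolding padic_zero_def using equiv_class_self[OF equiv_padic_rel[OF prime_p] C] .
  hence "padic_expansion p (padic_zero p) (\<lambda>_. 0)"
    using prime_gt_0_nat[OF prime_p] by (simp add: padic_expansion_def)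
  thus "padic_digit p (padic_zero p) = (\<lambda>_. 0)" by (rule padic_digit_eqI[OF Q])
qed

lemma Qp_eq_class:
  assumes "x \<in> Qp p"
  shows "(\<lambda>N. partial_sum p (padic_digit p x) N) \<in> padic_Cauchy p"
    and "x = padic_rel p `` {\<lambda>N. partial_sum p (padic_digit p x) N}"
proof -
  have X: "(\<lambda>N. partial_sum p (padic_digit p x) N) \<in> x"
    using padic_digit_expansion[OF assms] by (simp add: padic_expansion_def)
  show C: "(\<lambda>N. partial_sum p (padic_digit p x) N) \<in> padic_Cauchy p"
    using padic_digit_bounded_below[OF assms] partial_sum_Cauchy[OF prime_p] by blast
  show "x = padic_rel p `` {\<lambda>N. partial_sum p (padic_digit p x) N}"
    using quotient_disj[OF equiv_padic_rel[OF prime_p], of x "padic_rel p `` {\<lambda>N. partial_sum p (padic_digit p x) N}"]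
      assms X quotientI[OF C] equiv_class_self[OF equiv_padic_rel[OF prime_p] C]
    unfolding Qp_def by blast
qed

lemma padic_eqI:
  assumes "x \<in> Qp p" "y \<in> Qp p" "padic_digit p x = padic_digit p y"
  shows "x = y"
  using Qp_eq_class(2)[OF assms(1)] Qp_eq_class(2)[OF assms(2)] assms(3) by simp

lemma padic_val_props:
  assumes "x \<in> Qp p" "x \<noteq> padic_zero p"
  shows "padic_digit p x (padic_val p x) \<noteq> 0" "n < padic_val p x \<Longrightarrow> padic_digit p x n = 0"
proof -
  obtain L where L: "\<forall>n<L. padic_digit p x n = 0" using padic_digit_bounded_below[OF assms(1)] by blast
  have "padic_digit p x \<noteq> (\<lambda>_. 0)"
    using padic_eqI[OF assms(1) padic_zero_in_Qp] assms(2) unfolding padic_digit_zero by metis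
  then obtain n0 where "padic_digit p x n0 \<noteq> 0" by (auto simp: fun_eq_iff)
  note least = int_Least_nonzero[OF L this, folded padic_val_def]
  show "padic_digit p x (padic_val p x) \<noteq> 0" by (fact least(1))
  show "n < padic_val p x \<Longrightarrow> padic_digit p x n = 0" using least(2) by simp
qed

lemma partial_sum_val_ge:
  assumes "\<And>n. d n < p" "\<forall>n<v. d n = 0" "d v \<noteq> 0" "- int N \<le> v" "v \<le> int N"
  shows "val_ge p v (partial_sum p d N)" "\<not> val_ge p (v + 1) (partial_sum p d N)"
proof -
  show "val_ge p v (partial_sum p d N)"
    using partial_sum_tail[OF prime_p assms(2,4), of v] assms(5) by simp
  show "\<not> val_ge p (v + 1) (partial_sum p d N)"
  proof
    assume a: "val_ge p (v + 1) (partial_sum p d N)"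
    have eq: "{v..<v+1} = {v}" by auto
    have "val_ge p (v + 1) (partial_sum p d N - of_nat (d v) * of_nat p powi v)"
      using partial_sum_tail[OF prime_p assms(2,4), of "v + 1"] assms(5) unfolding eq by simp
    from val_ge_diff[OF prime_p a this] have "val_ge p (v + 1) ((of_nat (d v) - of_nat 0) * of_nat p powi v)"
      by simp
    from digit_un[OF prime_p this] show False using assms(1)[of v] assms(3) by auto
  qed
qed

lemma padic_diff_class:
  assumes "X \<in> padic_Cauchy p" "Y \<in> padic_Cauchy p"
  shows "(\<lambda>i. X i - Y i) \<in> padic_Cauchy p"
    and "padic_diff p (padic_rel p `` {X}) (padic_rel p `` {Y}) = padic_rel p `` {\<lambda>i. X i - Y i}"
proof -
  note rel = rel_iff[OF prime_p]
  have C: "(\<lambda>i. X i - Y i) \<in> padic_Cauchy p" if XY: "X \<in> padic_Cauchy p" "Y \<in> padic_Cauchy p" for X Y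
    unfolding Cauchy_val_ge_iff[OF prime_p]
  proof
    fix n
    obtain M1 M2 where M: "\<forall>i\<ge>M1. \<forall>j\<ge>M1. val_ge p n (X i - X j)" "\<forall>i\<ge>M2. \<forall>j\<ge>M2. val_ge p n (Y i - Y j)"
      using XY unfolding Cauchy_val_ge_iff[OF prime_p] by meson
    have "val_ge p n ((X i - Y i) - (X j - Y j))" if "i \<ge> max M1 M2" "j \<ge> max M1 M2" for i j
    proof -
      have "val_ge p n ((X i - X j) - (Y i - Y j))" by (rule val_ge_diff[OF prime_p]) (use M that in auto)
      thus ?thesis by (simp add: algebra_simps)
    qed
    thus "\<exists>M. \<forall>i\<ge>M. \<forall>j\<ge>M. val_ge p n ((X i - Y i) - (X j - Y j))" by blast
  qed
  show "(\<lambda>i. X i - Y i) \<in> padic_Cauchy p" by (rule C[OF assms])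
  have "congruent2 (padic_rel p) (padic_rel p) (\<lambda>X Y. padic_rel p `` {\<lambda>i. X i - Y i})"
  proof (rule congruent2I')
    fix X X' Y Y' assume h: "(X, X') \<in> padic_rel p" "(Y, Y') \<in> padic_rel p"
    have "((\<lambda>i. X i - Y i), (\<lambda>i. X' i - Y' i)) \<in> padic_rel p"
      unfolding rel
    proof (intro conjI allI C)
      fix n
      obtain M1 M2 where M: "\<forall>i\<ge>M1. val_ge p n (X i - X' i)" "\<forall>i\<ge>M2. val_ge p n (Y i - Y' i)"
        using h unfolding rel by meson
      have "val_ge p n ((X i - Y i) - (X' i - Y' i))" if "i \<ge> max M1 M2" for i
      proof -
        have "val_ge p n ((X i - X' i) - (Y i - Y' i))" by (rule val_ge_diff[OF prime_p]) (use M that in auto)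
        thus ?thesis by (simp add: algebra_simps)
      qed
      thus "\<exists>M. \<forall>i\<ge>M. val_ge p n ((X i - Y i) - (X' i - Y' i))" by blast
    qed (use h in \<open>auto simp: rel\<close>)
    thus "padic_rel p `` {\<lambda>i. X i - Y i} = padic_rel p `` {\<lambda>i. X' i - Y' i}"
      by (rule equiv_class_eq[OF equiv_padic_rel[OF prime_p]])
  qed
  from UN_equiv_class2[OF equiv_padic_rel[OF prime_p] equiv_padic_rel[OF prime_p] this assms]
  show "padic_diff p (padic_rel p `` {X}) (padic_rel p `` {Y}) = padic_rel p `` {\<lambda>i. X i - Y i}"
    unfolding padic_diff_def .
qed

text \<open>Because of borrowing, the digits of \<open>x - y\<close> are not the differences of the digits. Only the
  valuation of the partial sums is compared: modulo valuation \<open>n + 1\<close>, those of \<open>x - y\<close>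
  eventually coincide with the differences \<open>q\<close>, whose valuation is exactly \<open>n\<close>.\<close>

lemma padic_abs_diff_eq:
  assumes x: "x \<in> Qp p" and y: "y \<in> Qp p"
    and agree: "\<And>k. k < n \<Longrightarrow> padic_digit p x k = padic_digit p y k"
    and differ: "padic_digit p x n \<noteq> padic_digit p y n"
  shows "padic_abs p (padic_diff p x y) = real p powi (- n)"
proof -
  define c d where "c = padic_digit p x" and "d = padic_digit p y"
  define z where "z = padic_diff p x y"
  define q where "q N = partial_sum p c N - partial_sum p d N" for N
  have zq: "z = padic_rel p `` {q}" and q: "q \<in> padic_Cauchy p"
    using padic_diff_class[OF Qp_eq_class(1)[OF x] Qp_eq_class(1)[OF y]] Qp_eq_class(2)[OF x] Qp_eq_class(2)[OF y]
    unfolding z_def q_def c_def d_def by (simp_all add: fun_eq_iff)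
  have z: "z \<in> Qp p" unfolding zq Qp_def by (rule quotientI[OF q])
  define e where "e = padic_digit p z"
  obtain L1 L2 where "\<forall>k<L1. c k = 0" "\<forall>k<L2. d k = 0"
    using padic_digit_bounded_below x y unfolding c_def d_def by meson
  then obtain L where L: "\<forall>k<L. c k = 0" "\<forall>k<L. d k = 0" "L \<le> n"
    by (intro that[of "min n (min L1 L2)"]) auto
  have qval: "val_ge p n (q N) \<and> \<not> val_ge p (n + 1) (q N)" if N: "- int N \<le> L" "n \<le> int N" for N
  proof -
    have eq: "(\<Sum>k\<in>{L..<n}. of_nat (c k) * of_nat p powi k) = (\<Sum>k\<in>{L..<n}. of_nat (d k) * (of_nat p :: rat) powi k)"
      by (intro sum.cong refl) (simp add: c_def d_def agree)
    have "val_ge p n (q N)"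
      using val_ge_diff[OF prime_p partial_sum_tail[OF prime_p L(1) N(1), of n] partial_sum_tail[OF prime_p L(2) N(1), of n]] N(2)
      unfolding q_def eq by simp
    moreover have "\<not> val_ge p (n + 1) (q N)"
    proof
      assume a: "val_ge p (n + 1) (q N)"
      have ins: "{L..<n+1} = insert n {L..<n}" using L(3) by auto
      have "val_ge p (n + 1) (q N - (of_nat (c n) - of_nat (d n)) * of_nat p powi n)"
        using val_ge_diff[OF prime_p partial_sum_tail[OF prime_p L(1) N(1), of "n+1"] partial_sum_tail[OF prime_p L(2) N(1), of "n+1"]] N(2)
        unfolding q_def ins by (simp add: eq algebra_simps)
      from val_ge_diff[OF prime_p a this] have "val_ge p (n + 1) ((of_nat (c n) - of_nat (d n)) * of_nat p powi n)"
        by simp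
      from digit_un[OF prime_p this] show False
        using padic_digit_less x y differ unfolding c_def d_def by blast
    qed
    ultimately show ?thesis by blast
  qed
  have "(q, \<lambda>N. partial_sum p e N) \<in> padic_rel p"
    using padic_digit_expansion[OF z] unfolding zq e_def padic_expansion_def by blast
  then obtain M where M: "\<And>i. i \<ge> M \<Longrightarrow> val_ge p (n + 1) (q i - partial_sum p e i)"
    unfolding rel_iff[OF prime_p] by blast
  have eval: "val_ge p n (partial_sum p e N) \<and> \<not> val_ge p (n + 1) (partial_sum p e N)"
    if N: "N \<ge> M" "- int N \<le> L" "n \<le> int N" for N
  proof -
    have "val_ge p n (q N - (q N - partial_sum p e N))"
      by (rule val_ge_diff[OF prime_p]) (use qval[OF N(2,3)] val_ge_mono[OF prime_p M[OF N(1)], of n] in auto)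
    moreover have "\<not> val_ge p (n + 1) (partial_sum p e N)"
      using qval[OF N(2,3)] val_ge_add[OF prime_p M[OF N(1)]] by fastforce
    ultimately show ?thesis by simp
  qed
  have nz: "z \<noteq> padic_zero p"
  proof
    assume "z = padic_zero p"
    hence "e = (\<lambda>_. 0)" by (simp add: e_def padic_digit_zero)
    moreover define N where "N = M + nat \<bar>L\<bar> + nat \<bar>n\<bar>"
    moreover have "N \<ge> M" "- int N \<le> L" "n \<le> int N" by (auto simp: N_def)
    ultimately show False using eval[of N] val_ge_0[OF prime_p] by simp
  qed
  define v where "v = padic_val p z"
  define N where "N = M + nat \<bar>L\<bar> + nat \<bar>n\<bar> + nat \<bar>v\<bar>"
  have N: "N \<ge> M" "- int N \<le> L" "n \<le> int N" "- int N \<le> v" "v \<le> int N" by (auto simp: N_def)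
  have v: "val_ge p v (partial_sum p e N)" "\<not> val_ge p (v + 1) (partial_sum p e N)"
    using partial_sum_val_ge[of e v N] padic_val_props[OF z nz] padic_digit_less[OF z] N
    unfolding v_def e_def by auto
  have "v = n"
  proof (rule linorder_cases[of v n])
    assume "v < n"
    thus ?thesis using v(2) eval[OF N(1-3)] val_ge_mono[OF prime_p, of n _ "v + 1"] by auto
  next
    assume "v > n"
    thus ?thesis using v(1) eval[OF N(1-3)] val_ge_mono[OF prime_p, of v _ "n + 1"] by auto
  qed
  thus ?thesis using nz unfolding padic_abs_def z_def v_def by simp
qed

end

section \<open>The map Upsilon in terms of digits\<close>

lemma norm_padic_chi [simp]: "cmod (padic_chi p m n x) = 1"
  by (simp add: padic_chi_def norm_exp_eq_Re)

text \<open>Only the digits up to \<open>n\<close> enter, and only through their position relative to \<open>n\<close>. The case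
  \<open>a = 0\<close> compares two points with common leading digits; the general case gives the self-similarity
  of the image.\<close>

lemma padic_chi_shift:
  assumes "\<And>k. k \<le> n \<Longrightarrow> padic_digit p x k = padic_digit p y (k + a)"
  shows "padic_chi p m n x = padic_chi p m (n + a) y"
proof -
  have "padic_digit p x (n - int k) = padic_digit p y (n + a - int k)" for k
    using assms[of "n - int k"] by (simp add: algebra_simps)
  thus ?thesis by (simp add: padic_chi_def)
qed

lemma padic_chi_eq_1:
  assumes "\<And>k. k \<le> n \<Longrightarrow> padic_digit p x k = 0"
  shows "padic_chi p m n x = 1"
  by (simp add: padic_chi_def assms)

context
  fixes p :: nat and m :: enat and s :: complex
  assumes prime_p: "prime p" and s_pos: "0 < cmod s" and s_less: "cmod s < 1"
begin

lemma s_neq: "s \<noteq> 0" "s \<noteq> 1" using s_pos s_less by auto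

lemma summable_Upsilon: "summable (\<lambda>j. s powi (L + int j) * padic_chi p m (L + int j) x)"
proof (rule summable_norm_cancel)
  have "summable (\<lambda>j. cmod s powi L * cmod s ^ j)"
    using s_less by (intro summable_mult summable_geometric) auto
  thus "summable (\<lambda>j. cmod (s powi (L + int j) * padic_chi p m (L + int j) x))"
    using s_neq by (simp add: norm_mult norm_power_int norm_power power_int_add)
qed

text \<open>All characters below the support of the digits are 1, so the closed term
  \<open>(1 - s powi v) / (1 - s)\<close> only replaces the missing part of a geometric series, and the sum may
  start at any index \<open>L\<close> below the valuation. This removes the valuation from the formula, so that
  two points can be compared term by term.\<close>

lemma Upsilon_eq:
  assumes x: "x \<in> Qp p" and below: "\<And>n. n < L \<Longrightarrow> padic_digit p x n = 0"
  shows "Upsilon p m s x = (1 - s powi L) / (1 - s) + (\<Sum>j. s powi (L + int j) * padic_chi p m (L + int j) x)"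
proof (cases "x = padic_zero p")
  case True
  have "(\<lambda>j. s powi L * s ^ j) sums (s powi L * (1 / (1 - s)))"
    using s_less by (intro sums_mult geometric_sums)
  hence "(\<Sum>j. s powi L * s ^ j) = s powi L / (1 - s)" by (simp add: sums_iff)
  thus ?thesis using s_neq True
    by (simp add: Upsilon_def padic_chi_eq_1 padic_digit_zero[OF prime_p] power_int_add field_simps)
next
  case False
  define U where "U L = (1 - s powi L) / (1 - s) + (\<Sum>j. s powi (L + int j) * padic_chi p m (L + int j) x)" for L
  have step: "U (L + int k) = U L" if "\<And>n. n < L + int k \<Longrightarrow> padic_digit p x n = 0" for k
    using that
  proof (induction k)
    case (Suc k)
    define M where "M = L + int k"
    have "padic_chi p m M x = 1" using Suc.prems by (intro padic_chi_eq_1) (auto simp: M_def)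
    hence "U M = (1 - s powi M) / (1 - s) + s powi M + (\<Sum>j. s powi (M + 1 + int j) * padic_chi p m (M + 1 + int j) x)"
      unfolding U_def using suminf_split_head[OF summable_Upsilon[of M x]] by (simp add: algebra_simps)
    also have "(1 - s powi M) / (1 - s) + s powi M = (1 - s powi (M + 1)) / (1 - s)"
      using s_neq by (simp add: field_simps power_int_add)
    finally show ?case using Suc by (simp add: U_def M_def algebra_simps)
  qed simp
  have "L \<le> padic_val p x" using padic_val_props(1)[OF prime_p x False] below[of "padic_val p x"] by (meson not_less)
  then obtain k where k: "padic_val p x = L + int k" by (metis zle_iff_zadd)
  have "Upsilon p m s x = U (padic_val p x)" using False by (simp add: Upsilon_def U_def)
  also have "\<dots> = U L" unfolding k using padic_val_props(2)[OF prime_p x False] k by (intro step) auto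
  finally show ?thesis by (simp add: U_def)
qed

lemma Upsilon_diff:
  assumes x: "x \<in> Qp p" and y: "y \<in> Qp p"
    and agree: "\<And>k. k < n \<Longrightarrow> padic_digit p x k = padic_digit p y k"
  shows "Upsilon p m s x - Upsilon p m s y
         = (\<Sum>j. s powi (n + int j) * (padic_chi p m (n + int j) x - padic_chi p m (n + int j) y))"
proof -
  obtain L1 where L1: "\<forall>k<L1. padic_digit p x k = 0" using padic_digit_bounded_below[OF prime_p x] by blast
  obtain L2 where L2: "\<forall>k<L2. padic_digit p y k = 0" using padic_digit_bounded_below[OF prime_p y] by blast
  define L where "L = min n (min L1 L2)"
  have L: "padic_digit p x k = 0" "padic_digit p y k = 0" if "k < L" for k
    using L1 L2 that by (auto simp: L_def)
  have Ln: "L \<le> n" by (simp add: L_def)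
  define f where "f j = s powi (L + int j) * (padic_chi p m (L + int j) x - padic_chi p m (L + int j) y)" for j
  have f: "f = (\<lambda>j. s powi (L + int j) * padic_chi p m (L + int j) x - s powi (L + int j) * padic_chi p m (L + int j) y)"
    by (auto simp: f_def algebra_simps)
  have "Upsilon p m s x - Upsilon p m s y = suminf f"
    unfolding f suminf_diff[OF summable_Upsilon summable_Upsilon, symmetric]
    using Upsilon_eq[OF x L(1)] Upsilon_eq[OF y L(2)] by simp
  also have "\<dots> = (\<Sum>j. f (j + nat (n - L))) + sum f {..<nat (n - L)}"
    unfolding f by (intro suminf_split_initial_segment summable_diff summable_Upsilon)
  also have "sum f {..<nat (n - L)} = 0"
  proof (intro sum.neutral ballI)
    fix j assume "j \<in> {..<nat (n - L)}"
    hence "padic_chi p m (L + int j) x = padic_chi p m (L + int j + 0) y"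
      by (intro padic_chi_shift) (auto intro!: agree)
    thus "f j = 0" by (simp add: f_def)
  qed
  also have "(\<lambda>j. f (j + nat (n - L))) = (\<lambda>j. s powi (n + int j) * (padic_chi p m (n + int j) x - padic_chi p m (n + int j) y))"
    using Ln by (auto simp: f_def fun_eq_iff algebra_simps)
  finally show ?thesis by simp
qed

lemma Upsilon_diff_le:
  assumes x: "x \<in> Qp p" and y: "y \<in> Qp p"
    and agree: "\<And>k. k < n \<Longrightarrow> padic_digit p x k = padic_digit p y k"
  shows "cmod (Upsilon p m s x - Upsilon p m s y) \<le> 2 / (1 - cmod s) * cmod s powi n"
proof -
  have sums: "(\<lambda>j. 2 * cmod s powi n * cmod s ^ j) sums (2 * cmod s powi n * (1 / (1 - cmod s)))"
    using s_less by (intro sums_mult geometric_sums) auto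
  have diff: "Upsilon p m s x - Upsilon p m s y
      = (\<Sum>j. s powi (n + int j) * (padic_chi p m (n + int j) x - padic_chi p m (n + int j) y))"
    by (rule Upsilon_diff[OF x y]) (rule agree)
  have "cmod (Upsilon p m s x - Upsilon p m s y) \<le> (\<Sum>j. 2 * cmod s powi n * cmod s ^ j)"
    unfolding diff
  proof (rule norm_suminf_le)
    fix j
    have "cmod (padic_chi p m (n + int j) x - padic_chi p m (n + int j) y) \<le> 2"
      using norm_triangle_ineq4[of "padic_chi p m (n + int j) x" "padic_chi p m (n + int j) y"] by simp
    hence "cmod s powi n * cmod s ^ j * cmod (padic_chi p m (n + int j) x - padic_chi p m (n + int j) y)
           \<le> cmod s powi n * cmod s ^ j * 2"
      using s_pos by (intro mult_left_mono) auto
    thus "cmod (s powi (n + int j) * (padic_chi p m (n + int j) x - padic_chi p m (n + int j) y))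
          \<le> 2 * cmod s powi n * cmod s ^ j"
      using s_neq by (simp add: norm_mult norm_power_int norm_power power_int_add mult_ac)
  qed (use sums in \<open>auto simp: sums_iff\<close>)
  thus ?thesis using sums by (simp add: sums_iff)
qed

text \<open>If \<open>x'\<close> and \<open>y'\<close> arise from \<open>x\<close> and \<open>y\<close> by moving the digits down by \<open>n\<close> places, then
  \<open>\<bar>x' - y'\<bar> = 1\<close>, so their images are at least \<open>\<Delta>\<close> apart, and
  \<open>\<Upsilon> x - \<Upsilon> y = s powi n * (\<Upsilon> x' - \<Upsilon> y')\<close> by the difference formula.\<close>

lemma Upsilon_diff_ge:
  assumes x: "x \<in> Qp p" and y: "y \<in> Qp p"
    and agree: "\<And>k. k < n \<Longrightarrow> padic_digit p x k = padic_digit p y k"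
    and differ: "padic_digit p x n \<noteq> padic_digit p y n"
  shows "Delta p m s * cmod s powi n \<le> cmod (Upsilon p m s x - Upsilon p m s y)"
proof -
  have shifted: "\<exists>w\<in>Qp p. padic_digit p w = (\<lambda>k. padic_digit p z (k + n))" if z: "z \<in> Qp p" for z
  proof -
    obtain L where "\<forall>k<L. padic_digit p z k = 0" using padic_digit_bounded_below[OF prime_p z] by blast
    thus ?thesis using padic_digit_less[OF prime_p z] by (intro Qp_of_digits[OF prime_p, of _ "L - n"]) auto
  qed
  obtain x' y' where x': "x' \<in> Qp p" "padic_digit p x' = (\<lambda>k. padic_digit p x (k + n))"
    and y': "y' \<in> Qp p" "padic_digit p y' = (\<lambda>k. padic_digit p y (k + n))"
    using shifted x y by meson
  have agree': "padic_digit p x' k = padic_digit p y' k" if "k < 0" for k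
    using agree[of "k + n"] that by (simp add: x' y')
  have chi: "padic_chi p m (int j) x' = padic_chi p m (n + int j) x"
       "padic_chi p m (int j) y' = padic_chi p m (n + int j) y" for j
    using padic_chi_shift[of "int j" p x' x n] padic_chi_shift[of "int j" p y' y n]
    by (simp_all add: x' y' add.commute)
  have "padic_abs p (padic_diff p x' y') = real p powi (- 0)"
    by (rule padic_abs_diff_eq[OF prime_p x'(1) y'(1)]) (use agree' differ in \<open>simp_all add: x' y'\<close>)
  hence "Delta p m s \<le> cmod (Upsilon p m s x' - Upsilon p m s y')"
    unfolding Delta_def using x'(1) y'(1) by (intro cInf_lower bdd_belowI[of _ 0]) auto
  hence "Delta p m s * cmod s powi n \<le> cmod (Upsilon p m s x' - Upsilon p m s y') * cmod s powi n"
    by (intro mult_right_mono) auto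
  also have "\<dots> = cmod (s powi n * (Upsilon p m s x' - Upsilon p m s y'))"
    by (simp add: norm_mult norm_power_int mult.commute)
  also have "s powi n * (Upsilon p m s x' - Upsilon p m s y') = Upsilon p m s x - Upsilon p m s y"
  proof -
    have "summable (\<lambda>j. s ^ j * (padic_chi p m (int j) x' - padic_chi p m (int j) y'))"
      using summable_diff[OF summable_Upsilon[of 0 x'] summable_Upsilon[of 0 y']]
      by (simp add: algebra_simps)
    note scaled = suminf_mult[OF this, of "s powi n"]
    have "Upsilon p m s x' - Upsilon p m s y'
        = (\<Sum>j. s powi (0 + int j) * (padic_chi p m (0 + int j) x' - padic_chi p m (0 + int j) y'))"
      by (rule Upsilon_diff[OF x'(1) y'(1)]) (rule agree')
    moreover have "Upsilon p m s x - Upsilon p m s y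
        = (\<Sum>j. s powi (n + int j) * (padic_chi p m (n + int j) x - padic_chi p m (n + int j) y))"
      by (rule Upsilon_diff[OF x y]) (rule agree)
    ultimately show ?thesis
      using scaled s_neq by (simp add: chi power_int_add mult.assoc)
  qed
  finally show ?thesis .
qed

end

section \<open>The dimension\<close>

context
  fixes p :: nat and m :: enat and s :: complex
  assumes prime_p: "prime p" and s_pos: "0 < cmod s" and s_less: "cmod s < 1"
begin

lemma D_exponent_pos: "0 < D_exponent p s"
  and norm_powr_D_exponent: "cmod s powr D_exponent p s = 1 / real p"
proof -
  have ln: "0 < ln (real p)" "ln (cmod s) < 0"
    using prime_gt_1_nat[OF prime_p] s_pos s_less by auto
  have D: "D_exponent p s = ln (real p) / (- ln (cmod s))"
    using ln by (simp add: D_exponent_def log_def field_simps)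
  show "0 < D_exponent p s" unfolding D using ln by (intro divide_pos_pos) auto
  have "D_exponent p s * ln (cmod s) = - ln (real p)" using ln by (simp add: D)
  thus "cmod s powr D_exponent p s = 1 / real p"
    using s_pos prime_gt_0_nat[OF prime_p] by (simp add: powr_def exp_minus inverse_eq_divide)
qed

text \<open>The ball \<open>B L\<close> of radius \<open>p ^ L\<close> is cut into the classes \<open>S f\<close> of points with prescribed digits
  \<open>f\<close> on the window \<open>I\<close> from \<open>- L\<close> to \<open>N - 1\<close>.\<close>

lemma hausdorff_measure_Upsilon_eq_0:
  assumes \<delta>: "D_exponent p s < \<delta>"
  shows "hausdorff_measure \<delta> (Upsilon p m s ` Qp p) = 0"
proof -
  define B where "B L = {x \<in> Qp p. \<forall>n < - int L. padic_digit p x n = 0}" for L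
  define C where "C = 2 / (1 - cmod s)"
  have C: "0 \<le> C" using s_less by (simp add: C_def)
  have p: "1 < real p" using prime_gt_1_nat[OF prime_p] by simp
  have "cmod s powr \<delta> < cmod s powr D_exponent p s"
    using s_pos s_less \<delta> by (intro powr_less_mono') auto
  hence small: "real p * cmod s powr \<delta> < 1" using p by (simp add: norm_powr_D_exponent field_simps)
  have "hausdorff_measure \<delta> (Upsilon p m s ` B L) = 0" for L
  proof (rule hausdorff_measure_eq_0_geometric_covers)
    fix N :: nat
    define I where "I = {- int L..<int N}"
    define G where "G = (\<Pi>\<^sub>E n\<in>I. {..<p})"
    define S where "S f = Upsilon p m s ` {x \<in> B L. restrict (padic_digit p x) I = f}" for f
    have "finite G" by (simp add: G_def I_def finite_PiE)
    have "card (S ` G) \<le> card G" by (rule card_image_le[OF \<open>finite G\<close>])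
    also have "card G = p ^ (L + N)"
      by (simp add: G_def I_def card_PiE nat_add_distrib add.commute)
    finally have card: "real (card (S ` G)) \<le> real p ^ L * real p ^ N"
      by (simp add: power_add of_nat_le_iff[symmetric, where 'a = real] del: of_nat_le_iff)
    have cover: "Upsilon p m s ` B L \<subseteq> \<Union>(S ` G)"
    proof
      fix z assume "z \<in> Upsilon p m s ` B L"
      then obtain x where x: "x \<in> B L" "z = Upsilon p m s x" by blast
      hence "restrict (padic_digit p x) I \<in> G"
        using padic_digit_less[OF prime_p] by (auto simp: G_def B_def)
      thus "z \<in> \<Union>(S ` G)" using x by (auto simp: S_def)
    qed
    have close: "dist z w \<le> C * cmod s ^ N" if "z \<in> S f" "w \<in> S f" for z w f
    proof -
      obtain x y where xy: "x \<in> B L" "y \<in> B L" "z = Upsilon p m s x" "w = Upsilon p m s y"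
          "restrict (padic_digit p x) I = restrict (padic_digit p y) I"
        using \<open>z \<in> S f\<close> \<open>w \<in> S f\<close> unfolding S_def by auto
      have agree: "padic_digit p x k = padic_digit p y k" if "k < int N" for k
      proof (cases "k \<in> I")
        case True
        thus ?thesis using fun_cong[OF xy(5), of k] by simp
      next
        case False
        thus ?thesis using xy(1,2) that by (auto simp: B_def I_def)
      qed
      have "cmod (Upsilon p m s x - Upsilon p m s y) \<le> 2 / (1 - cmod s) * cmod s powi int N"
        by (rule Upsilon_diff_le[OF prime_p s_pos s_less]) (use agree xy in \<open>auto simp: B_def\<close>)
      thus ?thesis using xy by (simp add: dist_norm C_def)
    qed
    have "bounded U \<and> diameter U \<le> C * cmod s ^ N" if "U \<in> S ` G" for U
    proof
      show "bounded U" unfolding bounded_two_points using that close by blast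
      show "diameter U \<le> C * cmod s ^ N"
        using that close C by (intro diameter_le) (auto simp: dist_norm)
    qed
    thus "\<exists>F. finite F \<and> real (card F) \<le> real p ^ L * real p ^ N \<and> Upsilon p m s ` B L \<subseteq> \<Union>F \<and>
              (\<forall>U\<in>F. bounded U \<and> diameter U \<le> C * cmod s ^ N)"
      using card cover \<open>finite G\<close> by (intro exI[of _ "S ` G"]) auto
  qed (use C p small s_pos s_less \<delta> D_exponent_pos in auto)
  hence "hausdorff_measure \<delta> (\<Union>L. Upsilon p m s ` B L) = 0"
    by (rule hausdorff_measure_Union_eq_0)
  moreover have "Qp p = (\<Union>L. B L)"
  proof -
    have "x \<in> (\<Union>L. B L)" if x: "x \<in> Qp p" for x
    proof -
      obtain L where "\<forall>n<L. padic_digit p x n = 0" using padic_digit_bounded_below[OF prime_p x] by blast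
      hence "x \<in> B (nat (- L))" using x by (auto simp: B_def)
      thus ?thesis by blast
    qed
    thus ?thesis by (auto simp: B_def)
  qed
  ultimately show ?thesis by (simp add: image_UN)
qed

text \<open>The map \<open>t \<mapsto> \<Upsilon> (y t)\<close>, where \<open>y t\<close> has the digits of \<open>x\<close> below \<open>N\<close> followed by the
  base \<open>p\<close> digits of \<open>t\<close>, is inverse Hoelder with exponent \<open>D\<close> on \<open>[0,1)\<close>.\<close>

lemma hausdorff_dim_Upsilon_open_ge:
  assumes \<Delta>: "0 < Delta p m s" and x: "x \<in> Qp p" and U: "open U" "Upsilon p m s x \<in> U"
  shows "ereal (D_exponent p s) \<le> hausdorff_dim (Upsilon p m s ` Qp p \<inter> U)"
proof -
  let ?D = "D_exponent p s"
  have p: "1 < real p" "0 < p" using prime_gt_1_nat[OF prime_p] by auto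
  obtain e where e: "0 < e" "ball (Upsilon p m s x) e \<subseteq> U" using U open_contains_ball by blast
  have "(\<lambda>N. 2 / (1 - cmod s) * cmod s ^ N) \<longlonglongrightarrow> 2 / (1 - cmod s) * 0"
    by (intro tendsto_intros LIMSEQ_realpow_zero) (use s_less in auto)
  hence "\<forall>\<^sub>F N in sequentially. 2 / (1 - cmod s) * cmod s ^ N < e"
    using e by (simp only: order_tendstoD mult_zero_right)
  then obtain N where N: "2 / (1 - cmod s) * cmod s ^ N < e" by (auto simp: eventually_sequentially)
  define c where "c t n = (if n < int N then padic_digit p x n else nat (\<lfloor>t * real p ^ (nat (n - int N) + 1)\<rfloor> mod int p))"
    for t :: real and n
  have "\<exists>y\<in>Qp p. padic_digit p y = c t" for t
  proof -
    obtain L where "\<forall>n<L. padic_digit p x n = 0" using padic_digit_bounded_below[OF prime_p x] by blast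
    thus ?thesis using padic_digit_less[OF prime_p x] p
      by (intro Qp_of_digits[OF prime_p, of _ "min L (int N)"]) (auto simp: c_def nat_less_iff)
  qed
  then obtain y where y: "\<And>t. y t \<in> Qp p" "\<And>t. padic_digit p (y t) = c t" by metis
  \<comment> \<open>The first \<open>j\<close> digits determine the integer part of \<open>t * p ^ j\<close>.\<close>
  have floors: "\<lfloor>t * real p ^ j\<rfloor> = \<lfloor>u * real p ^ j\<rfloor>"
    if "t \<in> {0..<1}" "u \<in> {0..<1}" "\<And>i. i < j \<Longrightarrow> c t (int N + int i) = c u (int N + int i)" for t u j
    using that(3)
  proof (induction j)
    case 0
    have "\<lfloor>t\<rfloor> = 0" "\<lfloor>u\<rfloor> = 0" using that(1,2) by (auto simp: floor_eq_iff)
    thus ?case by simp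
  next
    case (Suc j)
    have dm: "\<lfloor>a * real p ^ Suc j\<rfloor> = \<lfloor>a * real p ^ j\<rfloor> * int p + int (c a (int N + int j))" for a
    proof -
      have "\<lfloor>a * real p ^ Suc j\<rfloor> div int p = \<lfloor>a * real p ^ j\<rfloor>"
        using floor_divide_real_eq_div[of "int p" "a * real p ^ Suc j"] p by simp
      moreover have "int (c a (int N + int j)) = \<lfloor>a * real p ^ Suc j\<rfloor> mod int p"
        using p by (simp add: c_def)
      ultimately show ?thesis by (metis div_mult_mod_eq)
    qed
    show ?case unfolding dm using Suc by simp
  qed
  have near: "\<bar>t - u\<bar> < (1 / real p) ^ j"
    if "t \<in> {0..<1}" "u \<in> {0..<1}" "\<And>i. i < j \<Longrightarrow> c t (int N + int i) = c u (int N + int i)" for t u j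
  proof -
    have "\<lfloor>t * real p ^ j\<rfloor> = \<lfloor>u * real p ^ j\<rfloor>" by (rule floors) (use that in auto)
    hence "\<bar>t * real p ^ j - u * real p ^ j\<bar> < 1" by linarith
    hence "\<bar>t - u\<bar> * real p ^ j < 1" using p by (simp add: abs_mult flip: left_diff_distrib)
    thus ?thesis using p by (simp add: field_simps)
  qed
  show ?thesis
  proof (rule hausdorff_dim_ge_inverse_Holder[where h = "\<lambda>t. Upsilon p m s (y t)"])
    fix t :: real
    have "cmod (Upsilon p m s (y t) - Upsilon p m s x) \<le> 2 / (1 - cmod s) * cmod s powi int N"
      by (rule Upsilon_diff_le[OF prime_p s_pos s_less y(1) x]) (simp add: y c_def)
    hence "Upsilon p m s (y t) \<in> ball (Upsilon p m s x) e"
      using N by (simp add: dist_norm norm_minus_commute)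
    thus "Upsilon p m s (y t) \<in> Upsilon p m s ` Qp p \<inter> U" using e y(1) by blast
  next
    fix t u :: real assume t: "t \<in> {0..<1}" and u: "u \<in> {0..<1}"
    show "\<bar>t - u\<bar> \<le> real p ^ N / Delta p m s powr ?D * dist (Upsilon p m s (y t)) (Upsilon p m s (y u)) powr ?D"
    proof (cases "t = u")
      case False
      have "\<exists>j. c t (int N + int j) \<noteq> c u (int N + int j)"
      proof (rule ccontr)
        assume "\<not> ?thesis"
        hence *: "\<bar>t - u\<bar> < (1 / real p) ^ j" for j using near[OF t u] by blast
        obtain j where "(1 / real p) ^ j < \<bar>t - u\<bar>"
          using real_arch_pow_inv[of "\<bar>t - u\<bar>" "1 / real p"] False p by auto
        thus False using *[of j] by simp
      qed
      define j where "j = (LEAST j. c t (int N + int j) \<noteq> c u (int N + int j))"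
      have j: "c t (int N + int j) \<noteq> c u (int N + int j)"
        unfolding j_def by (rule LeastI_ex) fact
      have below: "c t (int N + int i) = c u (int N + int i)" if "i < j" for i
        using not_less_Least[OF that[unfolded j_def]] by blast
      have agree: "padic_digit p (y t) k = padic_digit p (y u) k" if "k < int N + int j" for k
      proof (cases "k < int N")
        case False
        thus ?thesis using below[of "nat (k - int N)"] that by (simp add: y)
      qed (simp add: y c_def)
      have "Delta p m s * cmod s powi (int N + int j) \<le> cmod (Upsilon p m s (y t) - Upsilon p m s (y u))"
        by (rule Upsilon_diff_ge[OF prime_p s_pos s_less y(1) y(1)]) (use agree j in \<open>simp_all add: y\<close>)
      hence "Delta p m s * cmod s ^ (N + j) \<le> dist (Upsilon p m s (y t)) (Upsilon p m s (y u))"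
        by (simp add: dist_norm flip: power_int_of_nat)
      hence "(Delta p m s * cmod s ^ (N + j)) powr ?D \<le> dist (Upsilon p m s (y t)) (Upsilon p m s (y u)) powr ?D"
        using \<Delta> D_exponent_pos by (intro powr_mono2) auto
      also have "(Delta p m s * cmod s ^ (N + j)) powr ?D = Delta p m s powr ?D * (cmod s powr ?D) ^ (N + j)"
        using \<Delta> s_pos by (simp add: powr_mult powr_powr mult.commute flip: powr_realpow)
      finally have "Delta p m s powr ?D * (1 / real p) ^ (N + j) \<le> dist (Upsilon p m s (y t)) (Upsilon p m s (y u)) powr ?D"
        by (simp only: norm_powr_D_exponent)
      hence "(1 / real p) ^ j \<le> real p ^ N / Delta p m s powr ?D * dist (Upsilon p m s (y t)) (Upsilon p m s (y u)) powr ?D"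
        using \<Delta> p by (simp add: field_simps power_add)
      moreover have "\<bar>t - u\<bar> < (1 / real p) ^ j" by (rule near[OF t u]) (rule below)
      ultimately show ?thesis by simp
    qed simp
  next
    show "0 < real p ^ N / Delta p m s powr ?D" using p \<Delta> by simp
  qed (rule D_exponent_pos)
qed

end

theorem mainTheorem3:
  fixes p :: nat and m :: enat and s :: complex
  assumes "prime p"
    and "0 < cmod s" and "cmod s < 1"
    and "Delta p m s > 0"
  shows "hausdorff_dim (Upsilon p m s ` Qp p) = ereal (D_exponent p s) \<and>
         (\<forall>z \<in> Upsilon p m s ` Qp p.
            local_hausdorff_dim (Upsilon p m s ` Qp p) z = ereal (D_exponent p s))"
proof -
  let ?A = "Upsilon p m s ` Qp p" and ?D = "D_exponent p s"
  have le: "hausdorff_dim ?A \<le> ereal ?D"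
    using hausdorff_measure_Upsilon_eq_0[OF assms(1-3)] D_exponent_pos[OF assms(1-3)]
    by (intro hausdorff_dim_le) auto
  have ge: "ereal ?D \<le> hausdorff_dim (?A \<inter> U)" if "open U" "z \<in> ?A" "z \<in> U" for U z
    using hausdorff_dim_Upsilon_open_ge[OF assms(1-4)] that by auto
  have "ereal ?D \<le> hausdorff_dim ?A"
    using ge[of UNIV] padic_zero_in_Qp[OF assms(1)] by auto
  moreover have "local_hausdorff_dim ?A z = ereal ?D" if z: "z \<in> ?A" for z
  proof (rule antisym)
    have "local_hausdorff_dim ?A z \<le> hausdorff_dim (?A \<inter> UNIV)"
      unfolding local_hausdorff_dim_def by (intro INF_lower) auto
    thus "local_hausdorff_dim ?A z \<le> ereal ?D" using le by simp
    show "ereal ?D \<le> local_hausdorff_dim ?A z"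
      unfolding local_hausdorff_dim_def using ge z by (intro INF_greatest) auto
  qed
  ultimately show ?thesis using le by auto
qed

end
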